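(* Let $A=(A_1,A_2)$ be a commuting pure $2$-contraction on a complex Hilbert space $\mathcal{H}$ such that $D_{A^*}$ is one to one, and let $(z_1,z_2)\in\mathbb{D}^2$. Then $(z_1,z_2)\in\sigma_T^{(1)}(A_1,A_2)$ if and only if there exists $x\in\mathcal{H}$ such that, with $X_1=\begin{pmatrix} x \\ 0 \end{pmatrix}$ and $X_2=\begin{pmatrix} 0 \\ x \end{pmatrix}$ in $\mathcal{H}^2$, the vectors $D_A(X_1)$ and $D_A(X_2)$ are two nontrivial (i.e. nonzero) solutions of the equation $\theta_A(z_1,z_2)X=0$.
   Context: $\mathbb{D}^2=\{(z_1,z_2)\in\mathbb{C}^2: |z_1|^2+|z_2|^2<1\}$. A pair $A=(A_1,A_2)$ of bounded operators on $\mathcal{H}$ is a commuting $2$-contraction if $A_1A_2=A_2A_1$ and $\|A_1h_1+A_2h_2\|^2\le\|h_1\|^2+\|h_2\|^2$ for all $h_1,h_2\in\mathcal{H}$ (equivalently $A_1A_1^*+A_2A_2^*\le 1_{\mathcal{H}}$). $A$ is also regarded as the operator $A:\mathcal{H}^2\to\mathcal{H}$, $A(h_1,h_2)=A_1h_1+A_2h_2$, with adjoint $A^*h=(A_1^*h,A_2^*h)$. $A$ is pure if $P_A^n(1_{\mathcal{H}})\to 0$ strongly as $n\to\infty$, where $P_A(T)=A_1TA_1^*+A_2TA_2^*$. $D_{A^*}=(1_{\mathcal{H}}-AA^* )^{1/2}=(1_{\mathcal{H}}-A_1A_1^*-A_2A_2^* )^{1/2}$ on $\mathcal{H}$ and $D_A=(1_{\mathcal{H}^2}-A^*A)^{1/2}$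 on $\mathcal{H}^2$; $\mathcal{D}_{A^*}$ and $\mathcal{D}_A$ are the closures of the ranges of $D_{A^*}$ and $D_A$. The characteristic function of $A$ is $\theta_A:\mathbb{D}^2\to B(\mathcal{D}_A,\mathcal{D}_{A^*})$, $$\theta_A(z_1,z_2)=-A+D_{A^*}(1_{\mathcal{H}}-z_1A_1^*-z_2A_2^* )^{-1}(z_1 1_{\mathcal{H}},z_2 1_{\mathcal{H}})D_A$$ (restricted to $\mathcal{D}_A$), where $(z_1 1_{\mathcal{H}},z_2 1_{\mathcal{H}}):\mathcal{H}^2\to\mathcal{H}$ maps $(h_1,h_2)$ to $z_1h_1+z_2h_2$. $\sigma_T^{(1)}(A_1,A_2)$ is the set of $(z_1,z_2)\in\mathbb{C}^2$ for which there is $x\in\mathcal{H}$, $x\ne0$, with $(A_1-z_1)x=(A_2-z_2)x=0$. *)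

theory Defs
  imports "HOL-Analysis.Analysis"
begin

text \<open>
  The complex inner product is linear in its first argument. The inherited real inner product is
  required to be its real part, so that the norm and the topology coming from \<^class>\<open>real_inner\<close>
  are those of the complex inner product.
\<close>

class complex_inner = real_inner +
  fixes scaleC :: "complex \<Rightarrow> 'a \<Rightarrow> 'a" (infixr "*\<^sub>C" 75)
    and cinner :: "'a \<Rightarrow> 'a \<Rightarrow> complex"
  assumes scaleC_add_right: "c *\<^sub>C (x + y) = c *\<^sub>C x + c *\<^sub>C y"
    and scaleC_add_left: "(c + d) *\<^sub>C x = c *\<^sub>C x + d *\<^sub>C x"
    and scaleC_scaleC: "c *\<^sub>C d *\<^sub>C x = (c * d) *\<^sub>C x"
    and scaleC_one: "1 *\<^sub>C x = x"
    and scaleR_eq_scaleC: "r *\<^sub>R x = complex_of_real r *\<^sub>C x"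
    and cinner_commute: "cinner x y = cnj (cinner y x)"
    and cinner_add_left: "cinner (x + y) z = cinner x z + cinner y z"
    and cinner_scaleC_left: "cinner (c *\<^sub>C x) y = c * cinner x y"
    and inner_eq_Re_cinner: "inner x y = Re (cinner x y)"

class complex_hilbert = complex_inner + complete_space

instantiation complex :: complex_hilbert
begin

definition scaleC_complex :: "complex \<Rightarrow> complex \<Rightarrow> complex"
  where "scaleC_complex c x = c * x"

definition cinner_complex :: "complex \<Rightarrow> complex \<Rightarrow> complex"
  where "cinner_complex x y = x * cnj y"

instance
  by standard
    (simp_all add: scaleC_complex_def cinner_complex_def inner_complex_def scaleR_conv_of_real
      algebra_simps)

end

instantiation prod :: (complex_inner, complex_inner) complex_inner
begin

definition scaleC_prod :: "complex \<Rightarrow> 'a \<times> 'b \<Rightarrow> 'a \<times> 'b"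
  where "scaleC_prod c x = (c *\<^sub>C fst x, c *\<^sub>C snd x)"

definition cinner_prod :: "'a \<times> 'b \<Rightarrow> 'a \<times> 'b \<Rightarrow> complex"
  where "cinner_prod x y = cinner (fst x) (fst y) + cinner (snd x) (snd y)"

instance
proof
  fix x y :: "'a \<times> 'b"
  show "cinner x y = cnj (cinner y x)"
    using cinner_commute[of "fst x" "fst y"] cinner_commute[of "snd x" "snd y"]
    by (simp add: cinner_prod_def)
qed (simp_all add: scaleC_prod_def cinner_prod_def inner_prod_def scaleC_add_right
      scaleC_add_left scaleC_scaleC scaleC_one scaleR_prod_def scaleR_eq_scaleC cinner_add_left
      cinner_scaleC_left inner_eq_Re_cinner distrib_left)

end

instance prod :: (complex_hilbert, complex_hilbert) complex_hilbert ..

definition bounded_clinear :: "('a::complex_inner \<Rightarrow> 'b::complex_inner) \<Rightarrow> bool"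
  where "bounded_clinear T \<longleftrightarrow> bounded_linear T \<and> (\<forall>c x. T (c *\<^sub>C x) = c *\<^sub>C T x)"

text \<open>For bounded complex-linear \<open>T\<close>, existence follows from the Riesz representation theorem.\<close>

definition cadjoint :: "('a::complex_hilbert \<Rightarrow> 'b::complex_hilbert) \<Rightarrow> 'b \<Rightarrow> 'a"
  where "cadjoint T = (THE S. \<forall>x y. cinner (T x) y = cinner x (S y))"

definition positive_op :: "('a::complex_hilbert \<Rightarrow> 'a) \<Rightarrow> bool"
  where "positive_op T \<longleftrightarrow>
    bounded_clinear T \<and> (\<forall>x. cinner (T x) x \<in> \<real> \<and> 0 \<le> Re (cinner (T x) x))"

text \<open>The unique positive square root; it exists whenever \<open>T\<close> is positive.\<close>

definition sqrt_op :: "('a::complex_hilbert \<Rightarrow> 'a) \<Rightarrow> 'a \<Rightarrow> 'a"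
  where "sqrt_op T = (THE S. positive_op S \<and> S \<circ> S = T)"

definition commuting_2_contraction ::
    "('a::complex_hilbert \<Rightarrow> 'a) \<Rightarrow> ('a \<Rightarrow> 'a) \<Rightarrow> bool"
  where "commuting_2_contraction A1 A2 \<longleftrightarrow>
    bounded_clinear A1 \<and> bounded_clinear A2 \<and> A1 \<circ> A2 = A2 \<circ> A1 \<and>
    (\<forall>h1 h2. (norm (A1 h1 + A2 h2))\<^sup>2 \<le> (norm h1)\<^sup>2 + (norm h2)\<^sup>2)"

text \<open>
  A pair of operators is passed as two curried arguments; \<open>row_op A1 A2\<close> below is the pair
  regarded as an operator from the square of the space to the space.
\<close>

definition P_map ::
    "('a::complex_hilbert \<Rightarrow> 'a) \<Rightarrow> ('a \<Rightarrow> 'a) \<Rightarrow> ('a \<Rightarrow> 'a) \<Rightarrow> 'a \<Rightarrow> 'a"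
  where "P_map A1 A2 T = (\<lambda>h. A1 (T (cadjoint A1 h)) + A2 (T (cadjoint A2 h)))"

definition pure_pair :: "('a::complex_hilbert \<Rightarrow> 'a) \<Rightarrow> ('a \<Rightarrow> 'a) \<Rightarrow> bool"
  where "pure_pair A1 A2 \<longleftrightarrow> (\<forall>h. (\<lambda>n. (P_map A1 A2 ^^ n) (\<lambda>x. x) h) \<longlonglongrightarrow> 0)"

definition row_op ::
    "('a::complex_hilbert \<Rightarrow> 'a) \<Rightarrow> ('a \<Rightarrow> 'a) \<Rightarrow> 'a \<times> 'a \<Rightarrow> 'a"
  where "row_op A1 A2 = (\<lambda>(h1, h2). A1 h1 + A2 h2)"

definition defect_op ::
    "('a::complex_hilbert \<Rightarrow> 'a) \<Rightarrow> ('a \<Rightarrow> 'a) \<Rightarrow> 'a \<times> 'a \<Rightarrow> 'a \<times> 'a"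
  where "defect_op A1 A2 = sqrt_op (\<lambda>X. X - cadjoint (row_op A1 A2) (row_op A1 A2 X))"

definition defect_op_star ::
    "('a::complex_hilbert \<Rightarrow> 'a) \<Rightarrow> ('a \<Rightarrow> 'a) \<Rightarrow> 'a \<Rightarrow> 'a"
  where "defect_op_star A1 A2 = sqrt_op (\<lambda>h. h - row_op A1 A2 (cadjoint (row_op A1 A2) h))"

definition defect_space ::
    "('a::complex_hilbert \<Rightarrow> 'a) \<Rightarrow> ('a \<Rightarrow> 'a) \<Rightarrow> ('a \<times> 'a) set"
  where "defect_space A1 A2 = closure (range (defect_op A1 A2))"

definition unit_ball2 :: "(complex \<times> complex) set"
  where "unit_ball2 = {(z1, z2). (cmod z1)\<^sup>2 + (cmod z2)\<^sup>2 < 1}"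

text \<open>
  For \<open>(z1, z2)\<close> in the unit ball the operator being inverted is bijective, so \<^const>\<open>inv\<close> is its
  genuine inverse. The characteristic function has domain \<^const>\<open>defect_space\<close>, hence the
  restricted abstraction. Its values are left in the whole space, of which the closure of the
  range of \<^const>\<open>defect_op_star\<close> is a subspace.
\<close>

definition char_fun ::
    "('a::complex_hilbert \<Rightarrow> 'a) \<Rightarrow> ('a \<Rightarrow> 'a) \<Rightarrow> complex \<times> complex \<Rightarrow> 'a \<times> 'a \<Rightarrow> 'a"
  where "char_fun A1 A2 = (\<lambda>(z1, z2). \<lambda>X\<in>defect_space A1 A2.
    - row_op A1 A2 X +
    defect_op_star A1 A2
      (inv (\<lambda>h. h - z1 *\<^sub>C cadjoint A1 h - z2 *\<^sub>C cadjoint A2 h)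
        (row_op (\<lambda>h. z1 *\<^sub>C h) (\<lambda>h. z2 *\<^sub>C h) (defect_op A1 A2 X))))"

definition nontrivial_solution ::
    "('a::complex_hilbert \<Rightarrow> 'a) \<Rightarrow> ('a \<Rightarrow> 'a) \<Rightarrow> complex \<times> complex \<Rightarrow> 'a \<times> 'a \<Rightarrow> bool"
  where "nontrivial_solution A1 A2 z X \<longleftrightarrow>
    X \<in> defect_space A1 A2 \<and> char_fun A1 A2 z X = 0 \<and> X \<noteq> 0"

definition sigma_T1 ::
    "('a::complex_hilbert \<Rightarrow> 'a) \<Rightarrow> ('a \<Rightarrow> 'a) \<Rightarrow> (complex \<times> complex) set"
  where "sigma_T1 A1 A2 =
    {(z1, z2). \<exists>x. x \<noteq> 0 \<and> A1 x - z1 *\<^sub>C x = 0 \<and> A2 x - z2 *\<^sub>C x = 0}"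

end

theory Submission
  imports Defs
begin

text \<open>
  Write \<open>Z (h1, h2) = z1 h1 + z2 h2\<close>, so that \<open>W = Z A\<^sup>* = z1 A1\<^sup>* + z2 A2\<^sup>*\<close> is the operator in the
  resolvent. The whole matter is one identity: on vectors of the form \<open>D\<^sub>A X\<close> the characteristic
  function is \<open>\<theta>\<^sub>A(z) D\<^sub>A X = D\<^sub>A\<^sub>* (1 - W)\<^sup>-\<^sup>1 (Z - A) X\<close>.
  It follows from the intertwining relation \<open>A D\<^sub>A = D\<^sub>A\<^sub>* A\<close> (\<open>row_defect_intertwine\<close>) and from
  \<open>D\<^sub>A\<^sup>2 = 1 - A\<^sup>* A\<close>, because \<open>Z (1 - A\<^sup>* A) X - (1 - W) A X = (Z - A) X\<close>; this is
  \<open>char_fun_defect_op\<close>. In the open ball \<open>W\<close> has norm below one, so \<open>1 - W\<close> is bijective, and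
  \<open>D\<^sub>A\<^sub>*\<close> is injective by assumption. Hence \<open>\<theta>\<^sub>A(z) D\<^sub>A X = 0\<close> is equivalent to \<open>A X = Z X\<close>. For
  \<open>X = (x, 0)\<close> and \<open>X = (0, x)\<close> these are the equations \<open>A1 x = z1 x\<close> and \<open>A2 x = z2 x\<close>.

  It remains to compare the two conditions of being nonzero. If \<open>D\<^sub>A (x, 0) \<noteq> 0\<close>, then \<open>x \<noteq> 0\<close>.
  Conversely \<open>D\<^sub>A X = 0\<close> forces \<open>\<parallel>A X\<parallel> = \<parallel>X\<parallel>\<close>; for an eigenvector \<open>x\<close> and \<open>X = (x, 0)\<close> this
  says \<open>\<bar>z1\<bar> = 1\<close>, which is impossible in the open ball.

  The operator theory behind these lines is developed first: the Riesz representation theorem, which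
  gives adjoints, and the positive square root of \<open>1 - B\<close> for a self-adjoint contraction \<open>B\<close>. The
  root is given by the binomial series of \<open>(1 - t)\<^sup>1\<^sup>/\<^sup>2\<close> at \<open>B\<close>. Since that series
  is built from the powers of \<open>B\<close>, every operator that intertwines two contractions intertwines the
  two roots; this gives the relation \<open>A D\<^sub>A = D\<^sub>A\<^sub>* A\<close> as well as the uniqueness of the root.
\<close>

section \<open>The Riesz representation theorem\<close>

instance complex_hilbert \<subseteq> banach ..

text \<open>
  The first-order condition at a minimum, in the form in which variational arguments deliver it:
  otherwise a small \<open>t\<close> of sign opposite to \<open>b\<close> would make the expression negative.
\<close>

lemma linear_coeff_eq_0:
  fixes b c :: real
  assumes "\<And>t. 0 \<le> t * b + t\<^sup>2 * c"
  shows "b = 0"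
proof (rule ccontr)
  assume "b \<noteq> 0"
  define d where "d = \<bar>c\<bar> + 1"
  have d: "d > 0" "c < d" by (auto simp: d_def)
  \<comment> \<open>Since \<open>d > c\<close>, the quadratic term at \<open>t = - b / d\<close> is too small to offset the linear one.\<close>
  have "0 \<le> (- b / d) * b + (- b / d)\<^sup>2 * c" by (rule assms)
  also have "\<dots> = b\<^sup>2 / d\<^sup>2 * (c - d)"
    using d by (simp add: field_simps power2_eq_square)
  also have "\<dots> < 0"
    using d \<open>b \<noteq> 0\<close> by (intro mult_pos_neg) auto
  finally show False by simp
qed

text \<open>
  The representing vector is the minimiser of \<open>\<parallel>y\<parallel>\<^sup>2 - 2 f y\<close>, which if \<open>f = inner _ y0\<close> equals
  \<open>\<parallel>y - y0\<parallel>\<^sup>2 - \<parallel>y0\<parallel>\<^sup>2\<close>. The parallelogram law makes every minimising sequence Cauchy, and the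
  first-order condition at the minimum is the representation.
\<close>

lemma riesz_representation:
  fixes f :: "'a::{real_inner,complete_space} \<Rightarrow> real"
  assumes "bounded_linear f"
  shows "\<exists>y. \<forall>x. f x = inner x y"
proof -
  interpret f: bounded_linear f by fact
  define J where "J y = (norm y)\<^sup>2 - 2 * f y" for y
  obtain K where K: "\<And>x. norm (f x) \<le> norm x * K"
    using f.bounded by blast
  have lower: "- K\<^sup>2 \<le> J y" for y
  proof -
    have "0 \<le> (norm y - K)\<^sup>2" by simp
    then show ?thesis
      using K[of y] by (simp add: J_def power2_diff mult.commute)
  qed
  then have bdd: "bdd_below (range J)"
    by (intro bdd_belowI[of _ "- K\<^sup>2"]) auto
  define m where "m = Inf (range J)"
  have m: "m \<le> J y" for y
    unfolding m_def using bdd by (intro cInf_lower) auto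
  have "\<exists>u. J u < m + 1 / real (Suc n)" for n
    using cInf_lessD[of "range J" "m + 1 / real (Suc n)"] by (auto simp: m_def)
  then obtain u where u: "\<And>n. J (u n) < m + 1 / real (Suc n)" by metis
  have para: "(norm (v - w))\<^sup>2 \<le> 2 * (J v - m) + 2 * (J w - m)" for v w
  proof -
    have "J v + J w = 2 * J ((1/2) *\<^sub>R (v + w)) + (norm (v - w))\<^sup>2 / 2"
      unfolding J_def power2_norm_eq_inner f.scaleR f.add
      by (simp add: inner_simps inner_commute[of w v] field_simps)
    with m[of "(1/2) *\<^sub>R (v + w)"] show ?thesis by simp
  qed
  have "Cauchy u"
  proof (rule metric_CauchyI)
    fix e :: real assume "e > 0"
    then obtain N where N: "inverse (real (Suc N)) < e\<^sup>2 / 4"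
      using reals_Archimedean[of "e\<^sup>2 / 4"] by auto
    have J: "J (u n) - m < e\<^sup>2 / 4" if "n \<ge> N" for n
    proof -
      have "1 / real (Suc n) \<le> inverse (real (Suc N))"
        using that by (simp add: field_simps)
      then show ?thesis using u[of n] N by simp
    qed
    have "dist (u k) (u l) < e" if "k \<ge> N" "l \<ge> N" for k l
    proof -
      have "(norm (u k - u l))\<^sup>2 < e\<^sup>2"
        using para[of "u k" "u l"] J[OF that(1)] J[OF that(2)] by simp
      then show ?thesis
        using \<open>e > 0\<close> by (simp add: dist_norm power_less_imp_less_base)
    qed
    then show "\<exists>M. \<forall>k\<ge>M. \<forall>l\<ge>M. dist (u k) (u l) < e" by blast
  qed
  then obtain y where y: "u \<longlonglongrightarrow> y"
    by (auto simp: Cauchy_convergent_iff convergent_def)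
  have lim: "(\<lambda>n. J (u n)) \<longlonglongrightarrow> J y"
    unfolding J_def by (intro tendsto_intros y f.tendsto)
  have "(\<lambda>n. m + 1 / real (Suc n)) \<longlonglongrightarrow> m + 0"
    by (intro tendsto_intros LIMSEQ_Suc[OF lim_1_over_n])
  from LIMSEQ_le[OF lim this] have Jy: "J y \<le> m"
    using u less_imp_le by auto
  have "f x = inner x y" for x
  proof -
    have "0 \<le> t * (2 * (inner x y - f x)) + t\<^sup>2 * (norm x)\<^sup>2" for t
    proof -
      have "J (y + t *\<^sub>R x) = J y + (t * (2 * (inner x y - f x)) + t\<^sup>2 * (norm x)\<^sup>2)"
        unfolding J_def power2_norm_eq_inner f.scaleR f.add
        by (simp add: inner_simps inner_commute[of y x] power2_eq_square algebra_simps)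
      with Jy m[of "y + t *\<^sub>R x"] show ?thesis by simp
    qed
    from linear_coeff_eq_0[OF this] show ?thesis by simp
  qed
  then show ?thesis by blast
qed

section \<open>Complex inner products and adjoints\<close>

lemma cinner_add_right: "cinner x (y + z) = cinner x y + cinner x z"
  by (metis cinner_add_left cinner_commute complex_cnj_add)

lemma cinner_scaleC_right: "cinner x (c *\<^sub>C y) = cnj c * cinner x y"
  by (metis cinner_scaleC_left cinner_commute complex_cnj_mult)

lemma norm_scaleC: "norm (c *\<^sub>C x) = cmod c * norm (x::'a::complex_inner)"
proof -
  have "cinner (c *\<^sub>C x) (c *\<^sub>C x) = complex_of_real ((cmod c)\<^sup>2) * cinner x x"
    unfolding complex_norm_square
    by (simp add: cinner_scaleC_left cinner_scaleC_right)
  then have "(norm (c *\<^sub>C x))\<^sup>2 = (cmod c * norm x)\<^sup>2"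
    unfolding power2_norm_eq_inner power_mult_distrib inner_eq_Re_cinner
    by simp
  then show ?thesis by (simp add: power2_eq_iff_nonneg)
qed

lemma bounded_linear_scaleC: "bounded_linear (\<lambda>x::'a::complex_inner. c *\<^sub>C x)"
  by (rule bounded_linear_intro[where K = "cmod c"])
    (simp_all add: scaleC_add_right norm_scaleC scaleR_eq_scaleC scaleC_scaleC mult.commute)

lemma scaleC_zero_right [simp]: "c *\<^sub>C 0 = (0::'a::complex_inner)"
  by (rule linear_simps(3)[OF bounded_linear_scaleC])

text \<open>
  The real inner product determines the complex one, as \<open>Im c = - Re (\<i> c)\<close>. Adjoints and
  symmetric operators can thus be treated by means of the real inner product.
\<close>

lemma cinner_eqI_inner:
  fixes x y :: "'a::complex_inner" and u v :: "'b::complex_inner"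
  assumes "inner x y = inner u v" and "inner (\<i> *\<^sub>C x) y = inner (\<i> *\<^sub>C u) v"
  shows "cinner x y = cinner u v"
  using assms by (simp add: inner_eq_Re_cinner cinner_scaleC_left complex_eq_iff)

lemma bounded_clinear_scaleC:
  "bounded_clinear T \<Longrightarrow> T (c *\<^sub>C x) = c *\<^sub>C T x"
  by (simp add: bounded_clinear_def)

lemma bounded_clinear_bounded_linear: "bounded_clinear T \<Longrightarrow> bounded_linear T"
  by (simp add: bounded_clinear_def)

lemma bounded_clinear_comp:
  assumes "bounded_clinear S" "bounded_clinear T"
  shows "bounded_clinear (\<lambda>x. S (T x))"
  using assms by (auto simp: bounded_clinear_def intro: bounded_linear_compose)

lemma cadjoint_eqI:
  assumes "\<And>x y. cinner (T x) y = cinner x (S y)"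
  shows "cadjoint T = S"
  unfolding cadjoint_def
proof (rule the_equality)
  fix R assume "\<forall>x y. cinner (T x) y = cinner x (R y)"
  then have "inner x (R y) = inner x (S y)" for x y
    using assms by (simp add: inner_eq_Re_cinner)
  then show "R = S" by (metis ext vector_eq_ldot)
qed (use assms in simp)

text \<open>
  The Riesz theorem yields an adjoint for the real inner product; complex linearity of \<open>T\<close> makes it
  an adjoint for the complex one.
\<close>

lemma cinner_cadjoint:
  fixes T :: "'a::complex_hilbert \<Rightarrow> 'b::complex_hilbert"
  assumes T: "bounded_clinear T"
  shows "cinner (T x) y = cinner x (cadjoint T y)"
proof -
  have "bounded_linear (\<lambda>x. inner (T x) y)" for y
    using bounded_linear_compose[OF bounded_linear_inner_left bounded_clinear_bounded_linear[OF T]] .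
  then have "\<exists>s. \<forall>x. inner (T x) y = inner x s" for y
    by (rule riesz_representation)
  then obtain S where S: "\<And>x y. inner (T x) y = inner x (S y)" by metis
  have *: "cinner (T x) y = cinner x (S y)" for x y
    by (rule cinner_eqI_inner)
      (simp_all add: S flip: bounded_clinear_scaleC[OF T])
  from cadjoint_eqI[OF *] show ?thesis by (simp add: *)
qed

lemma inner_cadjoint:
  fixes T :: "'a::complex_hilbert \<Rightarrow> 'b::complex_hilbert"
  assumes "bounded_clinear T"
  shows "inner (T x) y = inner x (cadjoint T y)"
  by (simp add: inner_eq_Re_cinner cinner_cadjoint[OF assms])

lemma bounded_clinear_cadjoint:
  fixes T :: "'a::complex_hilbert \<Rightarrow> 'b::complex_hilbert"
  assumes T: "bounded_clinear T"
  shows "bounded_clinear (cadjoint T)"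
proof -
  let ?S = "cadjoint T"
  interpret T: bounded_linear T by (rule bounded_clinear_bounded_linear[OF T])
  obtain K where K: "K > 0" "\<And>x. norm (T x) \<le> norm x * K"
    using T.pos_bounded by blast
  have eqI: "u = v" if "\<And>x. cinner x u = cinner x v" for u v :: 'a
  proof -
    have "inner x u = inner x v" for x
      using that by (simp add: inner_eq_Re_cinner)
    then show ?thesis by (metis vector_eq_ldot)
  qed
  have add: "?S (y + z) = ?S y + ?S z" for y z
    by (rule eqI) (simp add: cinner_add_right flip: cinner_cadjoint[OF T])
  have scale: "?S (c *\<^sub>C y) = c *\<^sub>C ?S y" for c y
    by (rule eqI) (simp add: cinner_scaleC_right flip: cinner_cadjoint[OF T])
  have bound: "norm (?S y) \<le> norm y * K" for y
  proof (cases "?S y = 0")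
    case False
    have "norm (?S y) * norm (?S y) = inner (T (?S y)) y"
      by (simp add: inner_cadjoint[OF T] flip: power2_eq_square power2_norm_eq_inner)
    also have "\<dots> \<le> norm (T (?S y)) * norm y"
      by (rule norm_cauchy_schwarz)
    also have "\<dots> \<le> norm (?S y) * (norm y * K)"
      using mult_right_mono[OF K(2), of "norm y" "?S y"] by (simp add: mult_ac)
    finally show ?thesis using False by simp
  qed (use K in simp)
  show ?thesis
    unfolding bounded_clinear_def
    by (auto intro!: bounded_linear_intro[where K = K] simp: add scale bound scaleR_eq_scaleC)
qed

section \<open>The square root of one minus a contraction\<close>

text \<open>
  The Taylor coefficients of \<open>(1 - t)\<^sup>1\<^sup>/\<^sup>2\<close> at \<open>0\<close>. Three facts about them carry this section: all but
  the first are nonpositive, their partial sums are nonnegative, and the square of the power series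
  is \<open>1 - t\<close>. The first two give absolute summability, so the series may be evaluated at any operator
  of norm at most one, including the boundary case.
\<close>

definition sqrt_coeff :: "nat \<Rightarrow> real"
  where "sqrt_coeff n = (1/2 gchoose n) * (-1) ^ n"

lemma sqrt_coeff_0 [simp]: "sqrt_coeff 0 = 1"
  by (simp add: sqrt_coeff_def)

lemma sqrt_coeff_nonpos:
  assumes "n > 0"
  shows "sqrt_coeff n \<le> 0"
proof -
  obtain k where n: "n = Suc k" using assms gr0_implies_Suc by blast
  have "sqrt_coeff n = pochhammer (- (1/2)) n / fact n"
    by (simp add: sqrt_coeff_def gbinomial_pochhammer flip: power_mult_distrib)
  also have "\<dots> = - (1/2) * pochhammer (1/2) k / fact n"
    by (simp add: n pochhammer_rec)
  also have "\<dots> \<le> 0"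
    using pochhammer_nonneg[of "1/2::real" k] by (simp add: divide_simps)
  finally show ?thesis .
qed

text \<open>
  The partial sums of an alternating binomial series telescope to a single binomial coefficient,
  here one of \<open>(1 - t)\<^sup>-\<^sup>1\<^sup>/\<^sup>2\<close>, a power series with positive coefficients.
\<close>

lemma sum_sqrt_coeff_nonneg: "0 \<le> (\<Sum>n\<le>N. sqrt_coeff n)"
proof -
  have "(\<Sum>n\<le>N. sqrt_coeff n) = (-1) ^ N * (1/2 - 1 gchoose N)"
    unfolding sqrt_coeff_def by (rule gbinomial_sum_lower_neg)
  also have "\<dots> = pochhammer (1/2) N / fact N"
    by (simp add: gbinomial_pochhammer flip: power_mult_distrib)
  also have "\<dots> \<ge> 0"
    by (intro divide_nonneg_nonneg pochhammer_nonneg) auto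
  finally show ?thesis .
qed

lemma summable_abs_sqrt_coeff: "summable (\<lambda>n. \<bar>sqrt_coeff n\<bar>)"
proof (rule summableI_nonneg_bounded)
  fix N
  \<comment> \<open>Only the coefficient \<open>1\<close> at \<open>n = 0\<close> is positive, so changing all other signs gives \<open>1 - (s - 1)\<close>.\<close>
  have *: "(\<Sum>n\<le>N. \<bar>sqrt_coeff n\<bar>) = 2 - (\<Sum>n\<le>N. sqrt_coeff n)" for N
    by (induction N) (simp_all add: sqrt_coeff_nonpos abs_of_nonpos)
  have "(\<Sum>n<N. \<bar>sqrt_coeff n\<bar>) \<le> (\<Sum>n\<le>N. \<bar>sqrt_coeff n\<bar>)"
    by (rule sum_mono2) auto
  also have "\<dots> \<le> 2"
    using *[of N] sum_sqrt_coeff_nonneg[of N] by simp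
  finally show "(\<Sum>n<N. \<bar>sqrt_coeff n\<bar>) \<le> 2" .
qed simp

lemma suminf_sqrt_coeff_nonneg: "0 \<le> suminf sqrt_coeff"
proof -
  have "(\<lambda>N. \<Sum>n\<le>N. sqrt_coeff n) \<longlonglongrightarrow> suminf sqrt_coeff"
    using summable_rabs_cancel[OF summable_abs_sqrt_coeff] by (rule summable_LIMSEQ')
  then show ?thesis
    by (rule LIMSEQ_le_const) (auto intro: sum_sqrt_coeff_nonneg)
qed

text \<open>
  The Vandermonde identity expresses \<open>(1 - t)\<^sup>1\<^sup>/\<^sup>2 (1 - t)\<^sup>1\<^sup>/\<^sup>2 = 1 - t\<close> coefficientwise.
\<close>

lemma sqrt_coeff_convolution:
  "(\<Sum>k\<le>n. sqrt_coeff k * sqrt_coeff (n - k)) = (if n = 0 then 1 else if n = 1 then -1 else 0)"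
proof -
  have "(\<Sum>k\<le>n. sqrt_coeff k * sqrt_coeff (n - k))
      = (-1) ^ n * (\<Sum>k\<le>n. (1/2 gchoose k) * (1/2 gchoose (n - k)))"
    unfolding sum_distrib_left
  proof (rule sum.cong[OF refl])
    fix k assume "k \<in> {..n}"
    then have "(-1::real) ^ n = (-1) ^ k * (-1) ^ (n - k)"
      by (simp flip: power_add)
    then show "sqrt_coeff k * sqrt_coeff (n - k)
        = (-1) ^ n * ((1/2 gchoose k) * (1/2 gchoose (n - k)))"
      by (simp add: sqrt_coeff_def)
  qed
  also have "\<dots> = (-1) ^ n * (1 gchoose n)"
    using gbinomial_Vandermonde[of "1/2::real" "1/2" n] by (simp add: atLeast0AtMost)
  also have "(1 gchoose n) = real (1 choose n)"
    using binomial_gbinomial[of 1 n, where 'a = real] by simp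
  also have "(-1) ^ n * real (1 choose n) = (if n = 0 then 1 else if n = 1 then -1 else 0)"
    by (cases n) (auto simp: binomial_eq_0)
  finally show ?thesis .
qed

definition sqrt_series :: "('a::banach \<Rightarrow> 'a) \<Rightarrow> 'a \<Rightarrow> 'a"
  where "sqrt_series B x = (\<Sum>n. sqrt_coeff n *\<^sub>R (B ^^ n) x)"

locale linear_contraction =
  fixes B :: "'a::banach \<Rightarrow> 'a"
  assumes bounded_linear: "bounded_linear B"
    and norm_le: "norm (B x) \<le> norm x"
begin

lemma bounded_linear_funpow: "bounded_linear (B ^^ n)"
proof (induction n)
  case (Suc n)
  then show ?case
    using bounded_linear_compose[OF bounded_linear Suc] by (simp add: o_def)
qed (simp add: id_def)

lemma norm_funpow_le: "norm ((B ^^ n) x) \<le> norm x"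
  by (induction n) (auto intro: order_trans[OF norm_le])

lemma norm_term_le: "norm (sqrt_coeff n *\<^sub>R (B ^^ n) x) \<le> \<bar>sqrt_coeff n\<bar> * norm x"
  by (simp add: mult_left_mono norm_funpow_le)

lemma summable_norm_term: "summable (\<lambda>n. norm (sqrt_coeff n *\<^sub>R (B ^^ n) x))"
  by (rule summable_comparison_test'[OF summable_mult2[OF summable_abs_sqrt_coeff, of "norm x"]])
    (use norm_term_le in simp)

lemma summable_term: "summable (\<lambda>n. sqrt_coeff n *\<^sub>R (B ^^ n) x)"
  by (rule summable_norm_cancel[OF summable_norm_term])

lemma bounded_linear_sqrt_series: "bounded_linear (sqrt_series B)"
proof (rule bounded_linear_intro)
  fix x y :: 'a and r :: real
  have B: "(B ^^ n) (x + y) = (B ^^ n) x + (B ^^ n) y" "(B ^^ n) (r *\<^sub>R x) = r *\<^sub>R (B ^^ n) x" for n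
    using bounded_linear_funpow[of n]
    by (simp_all add: linear_simps)
  show "sqrt_series B (x + y) = sqrt_series B x + sqrt_series B y"
    unfolding sqrt_series_def B scaleR_add_right
    by (rule suminf_add[symmetric]) (rule summable_term)+
  show "sqrt_series B (r *\<^sub>R x) = r *\<^sub>R sqrt_series B x"
    unfolding sqrt_series_def B scaleR_left_commute[of _ r]
    by (rule suminf_scaleR_right[symmetric]) (rule summable_term)
  have "norm (sqrt_series B x) \<le> (\<Sum>n. norm (sqrt_coeff n *\<^sub>R (B ^^ n) x))"
    unfolding sqrt_series_def by (rule summable_norm[OF summable_norm_term])
  also have "\<dots> \<le> (\<Sum>n. \<bar>sqrt_coeff n\<bar> * norm x)"
    by (intro suminf_le norm_term_le summable_norm_term summable_mult2 summable_abs_sqrt_coeff)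
  also have "\<dots> = norm x * (\<Sum>n. \<bar>sqrt_coeff n\<bar>)"
    by (subst suminf_mult2[symmetric]) (simp_all add: summable_abs_sqrt_coeff mult.commute)
  finally show "norm (sqrt_series B x) \<le> norm x * (\<Sum>n. \<bar>sqrt_coeff n\<bar>)" .
qed

text \<open>
  A Cauchy product: the double family \<open>a\<^sub>k a\<^sub>l B\<^sup>k\<^sup>+\<^sup>l x\<close> is absolutely summable. Summed over \<open>l\<close> and
  then over \<open>k\<close> it gives the left-hand side; summed along the diagonals \<open>k + l = n\<close> it gives the
  right-hand side by the convolution identity.
\<close>

lemma sqrt_series_square: "sqrt_series B (sqrt_series B x) = x - B x"
proof -
  let ?f = "\<lambda>(k, l). (sqrt_coeff k * sqrt_coeff l) *\<^sub>R (B ^^ (k + l)) x"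
  have abs1: "(\<lambda>n. \<bar>sqrt_coeff n\<bar>) summable_on UNIV"
    using summable_abs_sqrt_coeff
    by (subst summable_on_UNIV_nonneg_real_iff) auto
  have "(\<lambda>(k, l). \<bar>sqrt_coeff k\<bar> * \<bar>sqrt_coeff l\<bar>) summable_on UNIV \<times> UNIV"
    by (rule summable_on_SigmaI)
      (auto intro: has_sum_cmult_right[OF has_sum_infsum[OF abs1]] summable_on_cmult_left[OF abs1])
  from summable_on_cmult_left[OF this, of "norm x"]
  have "(\<lambda>p. norm (?f p)) summable_on UNIV \<times> UNIV"
    by (rule summable_on_comparison_test)
      (auto simp: abs_mult norm_funpow_le mult_left_mono)
  then have sf: "?f summable_on UNIV \<times> UNIV"
    by (rule abs_summable_summable)
  have single: "((\<lambda>n. sqrt_coeff n *\<^sub>R (B ^^ n) y) has_sum sqrt_series B y) UNIV" for y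
    unfolding sqrt_series_def
    by (rule norm_summable_imp_has_sum[OF summable_norm_term summable_sums[OF summable_term]])
  have inner: "((\<lambda>l. ?f (k, l)) has_sum sqrt_coeff k *\<^sub>R (B ^^ k) (sqrt_series B x)) UNIV" for k
  proof -
    have bl: "bounded_linear (\<lambda>y. sqrt_coeff k *\<^sub>R (B ^^ k) y)"
      by (rule bounded_linear_const_scaleR[OF bounded_linear_funpow])
    show ?thesis
      using has_sum_bounded_linear[OF bl single[of x]]
      by (simp add: linear_simps[OF bounded_linear_funpow] funpow_add)
  qed
  have lhs: "(?f has_sum sqrt_series B (sqrt_series B x)) (UNIV \<times> UNIV)"
    using has_sum_SigmaI[OF inner single sf] .
  have bij: "bij_betw (\<lambda>(n, k). (k, n - k)) (SIGMA n:UNIV. {..n}) (UNIV \<times> UNIV :: (nat \<times> nat) set)"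
    by (rule bij_betwI[where g = "\<lambda>(k, l). (k + l, k)"]) auto
  have diag: "((\<lambda>p. ?f ((\<lambda>(n, k). (k, n - k)) p)) has_sum sqrt_series B (sqrt_series B x))
      (SIGMA n:UNIV. {..n})"
    using lhs has_sum_reindex_bij_betw[OF bij, of ?f] by simp
  have fin: "((\<lambda>k. ?f ((\<lambda>(n, k). (k, n - k)) (n, k))) has_sum
      (\<Sum>k\<le>n. sqrt_coeff k * sqrt_coeff (n - k)) *\<^sub>R (B ^^ n) x) {..n}" for n
    by (rule has_sum_finiteI) (auto simp: scaleR_left.sum)
  have "((\<lambda>n. (\<Sum>k\<le>n. sqrt_coeff k * sqrt_coeff (n - k)) *\<^sub>R (B ^^ n) x) has_sum
      sqrt_series B (sqrt_series B x)) UNIV"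
    by (rule has_sum_SigmaD[OF diag fin])
  moreover have "((\<lambda>n. (\<Sum>k\<le>n. sqrt_coeff k * sqrt_coeff (n - k)) *\<^sub>R (B ^^ n) x) has_sum
      x - B x) UNIV"
  proof (rule has_sum_finite_neutralI[of "{0, 1::nat}"])
  qed (auto simp: sqrt_coeff_convolution)
  ultimately show ?thesis by (rule has_sum_unique)
qed

end

text \<open>
  \<open>C B1 = B2 C\<close> passes to all powers, hence to the series. The case \<open>B1 = B2\<close> says that the root
  commutes with whatever commutes with \<open>B1\<close>.
\<close>

lemma sqrt_series_intertwine:
  assumes "linear_contraction B1" and C: "bounded_linear C"
    and CB: "\<And>x. C (B1 x) = B2 (C x)"
  shows "C (sqrt_series B1 x) = sqrt_series B2 (C x)"
proof -
  interpret linear_contraction B1 by fact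
  interpret C: bounded_linear C by fact
  have "C ((B1 ^^ n) x) = (B2 ^^ n) (C x)" for n
    by (induction n) (simp_all add: CB)
  then show ?thesis
    unfolding sqrt_series_def C.suminf[OF summable_term] by (simp add: C.scaleR)
qed

section \<open>Positive operators and uniqueness of the square root\<close>

lemma positive_opI:
  assumes T: "bounded_clinear T" and sym: "\<And>x y. inner (T x) y = inner x (T y)"
    and pos: "\<And>x. 0 \<le> inner (T x) x"
  shows "positive_op T"
proof -
  have "Im (cinner (T x) x) = 0" for x
    using sym[of "\<i> *\<^sub>C x" x]
    by (simp add: inner_eq_Re_cinner bounded_clinear_scaleC[OF T] cinner_scaleC_left
        cinner_commute[of x "T x"])
  then show ?thesis
    using T pos by (simp add: positive_op_def complex_is_Real_iff inner_eq_Re_cinner)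
qed

text \<open>
  On a complex space, reality of the quadratic form alone makes the operator self-adjoint.
\<close>

lemma positive_op_symmetric:
  assumes T: "positive_op T"
  shows "inner (T x) y = inner x (T y)"
proof -
  have cl: "bounded_clinear T" and real: "\<And>x. Im (cinner (T x) x) = 0"
    using T by (auto simp: positive_op_def complex_is_Real_iff)
  interpret bounded_linear T by (rule bounded_clinear_bounded_linear[OF cl])
  \<comment> \<open>Polarisation: the cross terms are \<open>- \<i> (T x, y) + \<i> (T y, x)\<close>, so their being real compares real parts.\<close>
  have "Im (cinner (T (x + \<i> *\<^sub>C y)) (x + \<i> *\<^sub>C y)) = 0" by (rule real)
  then have "Re (cinner (T x) y) = Re (cinner (T y) x)"
    using real[of x] real[of y]
    by (simp add: add bounded_clinear_scaleC[OF cl] cinner_add_left cinner_add_right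
        cinner_scaleC_left cinner_scaleC_right)
  then show ?thesis
    by (simp add: inner_eq_Re_cinner inner_commute[of x "T y"] flip: inner_eq_Re_cinner)
qed

text \<open>
  The form \<open>inner (T u) u\<close> has a minimum at \<open>u = y\<close>, so its derivative there in the direction
  \<open>T y\<close>, which is \<open>2 \<parallel>T y\<parallel>\<^sup>2\<close>, vanishes.
\<close>

lemma positive_op_null:
  assumes T: "positive_op T" and "inner (T y) y = 0"
  shows "T y = 0"
proof -
  interpret bounded_linear T
    using T by (simp add: positive_op_def bounded_clinear_def)
  have "0 \<le> t * (2 * inner (T y) (T y)) + t\<^sup>2 * inner (T (T y)) (T y)" for t
  proof -
    have "0 \<le> inner (T (y + t *\<^sub>R T y)) (y + t *\<^sub>R T y)"
      using T by (simp add: positive_op_def inner_eq_Re_cinner)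
    also have "\<dots> = t * (2 * inner (T y) (T y)) + t\<^sup>2 * inner (T (T y)) (T y)"
      using \<open>inner (T y) y = 0\<close> positive_op_symmetric[OF T, of "T y" y]
      by (simp add: add scaleR inner_simps power2_eq_square algebra_simps)
    finally show ?thesis .
  qed
  from linear_coeff_eq_0[OF this] show ?thesis by simp
qed

text \<open>
  Put \<open>y = (S - R) x\<close>. Commuting roots satisfy \<open>(S + R) y = (S\<^sup>2 - R\<^sup>2) x = 0\<close>, so both nonnegative
  numbers \<open>inner (S y) y\<close> and \<open>inner (R y) y\<close> vanish. Thus \<open>S y = R y = 0\<close>, and
  \<open>\<parallel>y\<parallel>\<^sup>2 = inner x ((S - R) y) = 0\<close>.
\<close>

lemma positive_sqrt_unique:
  assumes S: "positive_op S" and R: "positive_op R"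
    and sq: "\<And>x. S (S x) = R (R x)" and comm: "\<And>x. S (R x) = R (S x)"
  shows "S = R"
proof
  fix x
  interpret S: bounded_linear S
    using S by (simp add: positive_op_def bounded_clinear_def)
  interpret R: bounded_linear R
    using R by (simp add: positive_op_def bounded_clinear_def)
  define y where "y = S x - R x"
  have "S y + R y = 0"
    by (simp add: y_def S.diff R.diff sq comm)
  then have "inner (S y) y + inner (R y) y = 0"
    by (simp flip: inner_add_left)
  moreover have "0 \<le> inner (S y) y" "0 \<le> inner (R y) y"
    using S R by (simp_all add: positive_op_def inner_eq_Re_cinner)
  ultimately have "S y = 0" "R y = 0"
    by (auto intro: positive_op_null S R)
  have "inner y y = inner (S x) y - inner (R x) y"
    by (simp add: y_def inner_diff_left)
  also have "\<dots> = 0"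
    using positive_op_symmetric[OF S, of x y] positive_op_symmetric[OF R, of x y]
    by (simp add: \<open>S y = 0\<close> \<open>R y = 0\<close>)
  finally show "S x = R x" by (simp add: y_def)
qed

text \<open>
  For positivity, compare each term with its value at \<open>B = 1\<close>: since \<open>inner (B\<^sup>n x) x \<le> \<parallel>x\<parallel>\<^sup>2\<close> and the
  coefficients with \<open>n > 0\<close> are nonpositive, the form is at least \<open>\<parallel>x\<parallel>\<^sup>2\<close> times the sum of the
  coefficients, which is nonnegative.
\<close>

lemma positive_op_sqrt_series:
  fixes B :: "'a::complex_hilbert \<Rightarrow> 'a"
  assumes B: "bounded_clinear B" "\<And>x. norm (B x) \<le> norm x"
    and sym: "\<And>x y. inner (B x) y = inner x (B y)"
  shows "positive_op (sqrt_series B)"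
proof -
  interpret linear_contraction B
    using B by (intro linear_contraction.intro) (auto simp: bounded_clinear_def)
  have inner: "inner (sqrt_series B x) y = (\<Sum>n. sqrt_coeff n * inner ((B ^^ n) x) y)"
      "summable (\<lambda>n. sqrt_coeff n * inner ((B ^^ n) x) y)" for x y
    using bounded_linear.suminf[OF bounded_linear_inner_left[of y] summable_term[of x]]
      bounded_linear.summable[OF bounded_linear_inner_left[of y] summable_term[of x]]
    by (simp_all add: sqrt_series_def)
  have sym_n: "inner ((B ^^ n) x) y = inner x ((B ^^ n) y)" for n x y
    by (induction n arbitrary: y) (auto simp: sym, simp add: funpow_swap1)
  show ?thesis
  proof (rule positive_opI)
    show "bounded_clinear (sqrt_series B)"
      unfolding bounded_clinear_def
    proof (intro conjI allI)
      fix c x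
      show "sqrt_series B (c *\<^sub>C x) = c *\<^sub>C sqrt_series B x"
        using sqrt_series_intertwine[OF linear_contraction_axioms bounded_linear_scaleC[of c], of B x]
        by (simp add: bounded_clinear_scaleC[OF B(1)])
    qed (rule bounded_linear_sqrt_series)
  next
    fix x y
    show "inner (sqrt_series B x) y = inner x (sqrt_series B y)"
      by (simp add: inner inner_commute[of x "sqrt_series B y"] sym_n inner_commute[of x])
  next
    fix x :: 'a
    have "0 \<le> suminf sqrt_coeff * (norm x)\<^sup>2"
      using suminf_sqrt_coeff_nonneg by simp
    also have "\<dots> = (\<Sum>n. sqrt_coeff n * (norm x)\<^sup>2)"
      by (rule suminf_mult2[OF summable_rabs_cancel[OF summable_abs_sqrt_coeff]])
    also have "\<dots> \<le> (\<Sum>n. sqrt_coeff n * inner ((B ^^ n) x) x)"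
    proof (rule suminf_le)
      fix n
      have "inner ((B ^^ n) x) x \<le> norm ((B ^^ n) x) * norm x"
        by (rule norm_cauchy_schwarz)
      also have "\<dots> \<le> (norm x)\<^sup>2"
        by (simp add: norm_funpow_le mult_right_mono power2_eq_square)
      finally show "sqrt_coeff n * (norm x)\<^sup>2 \<le> sqrt_coeff n * inner ((B ^^ n) x) x"
        by (cases "n = 0") (auto simp: power2_norm_eq_inner intro!: mult_left_mono_neg sqrt_coeff_nonpos)
    qed (intro inner summable_mult2 summable_rabs_cancel[OF summable_abs_sqrt_coeff])+
    finally show "0 \<le> inner (sqrt_series B x) x"
      by (simp add: inner)
  qed
qed

text \<open>
  Any other positive root \<open>R\<close> commutes with \<open>R\<^sup>2 = 1 - B\<close>, hence with \<open>B\<close> and with the series,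
  so the uniqueness of commuting roots applies.
\<close>

lemma sqrt_op_eq_sqrt_series:
  fixes B :: "'a::complex_hilbert \<Rightarrow> 'a"
  assumes B: "bounded_clinear B" "\<And>x. norm (B x) \<le> norm x"
    and sym: "\<And>x y. inner (B x) y = inner x (B y)"
  shows "sqrt_op (\<lambda>x. x - B x) = sqrt_series B"
  unfolding sqrt_op_def
proof (rule the_equality)
  interpret linear_contraction B
    using B by (intro linear_contraction.intro) (auto simp: bounded_clinear_def)
  note pos = positive_op_sqrt_series[OF B sym]
  show "positive_op (sqrt_series B) \<and> sqrt_series B \<circ> sqrt_series B = (\<lambda>x. x - B x)"
    using pos by (auto simp: sqrt_series_square)
  fix R assume R: "positive_op R \<and> R \<circ> R = (\<lambda>x. x - B x)"
  then have sq: "R (R x) = x - B x" for x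
    by (metis comp_apply)
  interpret R: bounded_linear R
    using R by (simp add: positive_op_def bounded_clinear_def)
  have "R (B x) = B (R x)" for x
  proof -
    have "R x - R (B x) = R x - B (R x)"
      using sq[of "R x"] sq[of x] by (simp flip: R.diff)
    then show ?thesis by simp
  qed
  from sqrt_series_intertwine[OF linear_contraction_axioms R.bounded_linear_axioms this]
  have "sqrt_series B (R x) = R (sqrt_series B x)" for x by simp
  with pos R show "R = sqrt_series B"
    by (intro positive_sqrt_unique[symmetric]) (auto simp: sqrt_series_square sq)
qed

section \<open>Row contractions\<close>

locale row_contraction =
  fixes A1 A2 :: "'a::complex_hilbert \<Rightarrow> 'a"
  assumes clinear_A1: "bounded_clinear A1" and clinear_A2: "bounded_clinear A2"
    and row_contractive: "(norm (A1 h1 + A2 h2))\<^sup>2 \<le> (norm h1)\<^sup>2 + (norm h2)\<^sup>2"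
begin

abbreviation "A \<equiv> row_op A1 A2"
abbreviation "Aadj \<equiv> cadjoint A"
abbreviation "DA \<equiv> defect_op A1 A2"
abbreviation "DAs \<equiv> defect_op_star A1 A2"

lemma norm_row_le: "norm (A X) \<le> norm X"
  using row_contractive[of "fst X" "snd X"]
  by (simp add: row_op_def norm_prod_def real_le_rsqrt case_prod_unfold)

lemma clinear_row: "bounded_clinear A"
proof -
  interpret A1: bounded_linear A1 by (rule bounded_clinear_bounded_linear[OF clinear_A1])
  interpret A2: bounded_linear A2 by (rule bounded_clinear_bounded_linear[OF clinear_A2])
  show ?thesis
    unfolding bounded_clinear_def
  proof (intro conjI allI)
    show "bounded_linear A"
      by (rule bounded_linear_intro[where K = 1])
        (simp_all add: norm_row_le, simp_all add: row_op_def case_prod_unfold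
          A1.add A2.add A1.scaleR A2.scaleR scaleR_add_right)
  qed (simp add: row_op_def case_prod_unfold scaleC_prod_def bounded_clinear_scaleC[OF clinear_A1]
      bounded_clinear_scaleC[OF clinear_A2] scaleC_add_right)
qed

lemma row_adjoint: "Aadj = (\<lambda>h. (cadjoint A1 h, cadjoint A2 h))"
  by (rule cadjoint_eqI)
    (simp add: row_op_def case_prod_unfold cinner_prod_def cinner_add_left
      cinner_cadjoint[OF clinear_A1] cinner_cadjoint[OF clinear_A2])

lemmas clinear_row_adjoint = bounded_clinear_cadjoint[OF clinear_row]

lemma norm_row_adjoint_le: "norm (Aadj h) \<le> norm h"
proof (cases "Aadj h = 0")
  case False
  have "norm (Aadj h) * norm (Aadj h) = inner (A (Aadj h)) h"
    by (simp add: inner_cadjoint[OF clinear_row] flip: power2_eq_square power2_norm_eq_inner)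
  also have "\<dots> \<le> norm (A (Aadj h)) * norm h"
    by (rule norm_cauchy_schwarz)
  also have "\<dots> \<le> norm (Aadj h) * norm h"
    by (intro mult_right_mono norm_row_le) simp
  finally show ?thesis using False by simp
qed simp

lemma clinear_AsA: "bounded_clinear (\<lambda>X. Aadj (A X))"
  and clinear_AAs: "bounded_clinear (\<lambda>h. A (Aadj h))"
  by (rule bounded_clinear_comp[OF clinear_row_adjoint clinear_row]
      bounded_clinear_comp[OF clinear_row clinear_row_adjoint])+

lemma norm_AsA_le: "norm (Aadj (A X)) \<le> norm X"
  and norm_AAs_le: "norm (A (Aadj h)) \<le> norm h"
  by (rule order_trans[OF norm_row_adjoint_le norm_row_le]
      order_trans[OF norm_row_le norm_row_adjoint_le])+

lemma contraction_AsA: "linear_contraction (\<lambda>X. Aadj (A X))"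
  and contraction_AAs: "linear_contraction (\<lambda>h. A (Aadj h))"
  by (auto intro: linear_contraction.intro bounded_clinear_bounded_linear
      clinear_AsA clinear_AAs norm_AsA_le norm_AAs_le)

lemma inner_row_adjoint_left: "inner (Aadj h) X = inner h (A X)"
  by (metis inner_cadjoint[OF clinear_row] inner_commute)

lemma defect_op_eq: "DA = sqrt_series (\<lambda>X. Aadj (A X))"
  unfolding defect_op_def
  by (rule sqrt_op_eq_sqrt_series[OF clinear_AsA norm_AsA_le])
    (simp only: inner_row_adjoint_left inner_cadjoint[OF clinear_row])

lemma defect_op_star_eq: "DAs = sqrt_series (\<lambda>h. A (Aadj h))"
  unfolding defect_op_star_def
  by (rule sqrt_op_eq_sqrt_series[OF clinear_AAs norm_AAs_le])
    (simp only: inner_row_adjoint_left inner_cadjoint[OF clinear_row])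

lemma defect_op_square: "DA (DA X) = X - Aadj (A X)"
  unfolding defect_op_eq
  by (rule linear_contraction.sqrt_series_square[OF contraction_AsA])

text \<open>
  \<open>A (A\<^sup>* A) = (A A\<^sup>*) A\<close>, so \<open>A\<close> intertwines the two contractions and therefore their roots.
\<close>

lemma row_defect_intertwine: "A (DA X) = DAs (A X)"
  unfolding defect_op_eq defect_op_star_eq
  by (rule sqrt_series_intertwine[OF contraction_AsA bounded_clinear_bounded_linear[OF clinear_row]]) simp

lemma linear_defect_op: "bounded_linear DA"
  and linear_defect_op_star: "bounded_linear DAs"
  unfolding defect_op_eq defect_op_star_eq
  by (rule linear_contraction.bounded_linear_sqrt_series[OF contraction_AsA]
      linear_contraction.bounded_linear_sqrt_series[OF contraction_AAs])+

end

section \<open>The characteristic function\<close>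

lemma norm_scaleC_pair_le:
  "norm (z1 *\<^sub>C h1 + z2 *\<^sub>C h2) \<le> sqrt ((cmod z1)\<^sup>2 + (cmod z2)\<^sup>2) * norm (h1, h2 :: 'a::complex_inner)"
proof -
  have "norm (z1 *\<^sub>C h1 + z2 *\<^sub>C h2) \<le> cmod z1 * norm h1 + cmod z2 * norm h2"
    using norm_triangle_ineq[of "z1 *\<^sub>C h1" "z2 *\<^sub>C h2"] by (simp add: norm_scaleC)
  also have "\<dots> = inner (cmod z1, cmod z2) (norm h1, norm h2)"
    by simp
  also have "\<dots> \<le> norm (cmod z1, cmod z2) * norm (norm h1, norm h2)"
    by (rule norm_cauchy_schwarz)
  finally show ?thesis by (simp add: norm_prod_def)
qed

text \<open>
  The equation \<open>x - W x = y\<close> asks for a fixed point of the contraction \<open>x \<mapsto> y + W x\<close>.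
\<close>

lemma bij_id_minus_strict_contraction:
  fixes W :: "'a::banach \<Rightarrow> 'a"
  assumes W: "bounded_linear W" and c: "0 \<le> c" "c < 1" and le: "\<And>x. norm (W x) \<le> c * norm x"
  shows "bij (\<lambda>x. x - W x)"
proof (rule bijI')
  interpret bounded_linear W by fact
  fix y
  have "\<exists>!x\<in>UNIV. y + W x = x"
    using banach_fix_type[OF c, of "\<lambda>x. y + W x"] le by (simp add: dist_norm flip: diff)
  then show "\<exists>x. y = x - W x" by (metis add_diff_cancel_right')
next
  interpret bounded_linear W by fact
  fix x y
  show "x - W x = y - W y \<longleftrightarrow> x = y"
  proof
    assume "x - W x = y - W y"
    then have "W (x - y) = x - y" by (simp add: diff algebra_simps)
    with le[of "x - y"] have "(1 - c) * norm (x - y) \<le> 0" by (simp add: algebra_simps)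
    with c show "x = y" by (simp add: mult_le_0_iff)
  qed simp
qed

context row_contraction
begin

text \<open>
  The subtracted operator factors as the row \<open>(z1, z2)\<close>, of norm below one, after \<open>A\<^sup>*\<close>, of norm at
  most one.
\<close>

lemma bij_resolvent:
  assumes "(z1, z2) \<in> unit_ball2"
  shows "bij (\<lambda>h. h - z1 *\<^sub>C cadjoint A1 h - z2 *\<^sub>C cadjoint A2 h)"
proof -
  define c where "c = sqrt ((cmod z1)\<^sup>2 + (cmod z2)\<^sup>2)"
  have "bij (\<lambda>h. h - (z1 *\<^sub>C cadjoint A1 h + z2 *\<^sub>C cadjoint A2 h))"
  proof (rule bij_id_minus_strict_contraction[where c = c])
    show "bounded_linear (\<lambda>h. z1 *\<^sub>C cadjoint A1 h + z2 *\<^sub>C cadjoint A2 h)"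
      by (intro bounded_linear_add bounded_linear_compose[OF bounded_linear_scaleC]
          bounded_clinear_bounded_linear bounded_clinear_cadjoint clinear_A1 clinear_A2)
    show "0 \<le> c" "c < 1"
      using assms by (auto simp: c_def unit_ball2_def)
    fix h
    have "norm (z1 *\<^sub>C cadjoint A1 h + z2 *\<^sub>C cadjoint A2 h) \<le> c * norm (Aadj h)"
      unfolding c_def row_adjoint by (rule norm_scaleC_pair_le)
    also have "\<dots> \<le> c * norm h"
      using norm_row_adjoint_le by (simp add: mult_left_mono c_def)
    finally show "norm (z1 *\<^sub>C cadjoint A1 h + z2 *\<^sub>C cadjoint A2 h) \<le> c * norm h" .
  qed
  then show ?thesis by (simp add: diff_diff_add)
qed

lemma defect_op_in_defect_space: "DA X \<in> defect_space A1 A2"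
  unfolding defect_space_def by (rule subsetD[OF closure_subset rangeI])

text \<open>
  The identity that removes \<open>D\<^sub>A\<close> from the right: with \<open>V = 1 - Z A\<^sup>*\<close> the term \<open>- A D\<^sub>A X\<close> becomes
  \<open>- D\<^sub>A\<^sub>* V\<^sup>-\<^sup>1 V A X\<close> by intertwining, and in \<open>Z (1 - A\<^sup>* A) X - V A X\<close> the two terms \<open>Z A\<^sup>* A X\<close> cancel.
\<close>

lemma char_fun_defect_op:
  assumes "(z1, z2) \<in> unit_ball2"
  shows "char_fun A1 A2 (z1, z2) (DA X) =
    DAs (inv (\<lambda>h. h - z1 *\<^sub>C cadjoint A1 h - z2 *\<^sub>C cadjoint A2 h)
      (row_op (\<lambda>h. z1 *\<^sub>C h) (\<lambda>h. z2 *\<^sub>C h) X - A X))"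
proof -
  define Z :: "'a \<times> 'a \<Rightarrow> 'a" where "Z = row_op (\<lambda>h. z1 *\<^sub>C h) (\<lambda>h. z2 *\<^sub>C h)"
  define V where "V = (\<lambda>h. h - z1 *\<^sub>C cadjoint A1 h - z2 *\<^sub>C cadjoint A2 h)"
  have bij: "bij V" unfolding V_def by (rule bij_resolvent[OF assms])
  interpret DAs: bounded_linear DAs by (rule linear_defect_op_star)
  have V: "V h = h - Z (Aadj h)" for h
    by (simp add: V_def Z_def row_adjoint, simp add: row_op_def)
  have s: "bounded_linear (\<lambda>h::'a. c *\<^sub>C h)" for c by (rule bounded_linear_scaleC)
  have Z_diff: "Z (X - Y) = Z X - Z Y" for X Y
    by (simp add: Z_def row_op_def case_prod_unfold linear_simps[OF s])
  have V_add: "V (h + k) = V h + V k" for h k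
    unfolding V_def
    using linear_simps(1)[OF bounded_clinear_bounded_linear[OF bounded_clinear_cadjoint[OF clinear_A1]]]
      linear_simps(1)[OF bounded_clinear_bounded_linear[OF bounded_clinear_cadjoint[OF clinear_A2]]]
    by (simp add: scaleC_add_right)
  have "V (inv V (Z X - A X) + A X) = Z (DA (DA X))"
    by (simp add: V_add bij_is_surj[OF bij] surj_f_inv_f V[of "A X"] defect_op_square Z_diff)
  then have "inv V (Z (DA (DA X))) = inv V (Z X - A X) + A X"
    by (metis bij bij_is_inj inv_f_f)
  moreover have "char_fun A1 A2 (z1, z2) (DA X) = - A (DA X) + DAs (inv V (Z (DA (DA X))))"
    unfolding char_fun_def V_def Z_def prod.case by (rule restrict_apply'[OF defect_op_in_defect_space])
  ultimately have "char_fun A1 A2 (z1, z2) (DA X) = DAs (inv V (Z X - A X))"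
    by (simp only: row_defect_intertwine DAs.add) simp
  then show ?thesis by (simp only: V_def Z_def)
qed

lemma char_fun_defect_op_eq_0_iff:
  assumes "(z1, z2) \<in> unit_ball2" and inj: "inj DAs"
  shows "char_fun A1 A2 (z1, z2) (DA (x, y)) = 0 \<longleftrightarrow> A1 x + A2 y = z1 *\<^sub>C x + z2 *\<^sub>C y"
proof -
  define V where "V = (\<lambda>h. h - z1 *\<^sub>C cadjoint A1 h - z2 *\<^sub>C cadjoint A2 h)"
  have bij: "bij V" unfolding V_def by (rule bij_resolvent[OF assms(1)])
  have "V 0 = 0"
    using linear_simps(3)[OF bounded_clinear_bounded_linear[OF bounded_clinear_cadjoint[OF clinear_A1]]]
      linear_simps(3)[OF bounded_clinear_bounded_linear[OF bounded_clinear_cadjoint[OF clinear_A2]]]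
    by (simp add: V_def)
  then have V: "inv V h = 0 \<longleftrightarrow> h = 0" for h
    using bij_inv_eq_iff[OF bij, of 0 h] by auto
  have DAs: "DAs h = 0 \<longleftrightarrow> h = 0" for h
    using inj linear_simps(3)[OF linear_defect_op_star] by (metis injD)
  show ?thesis
    unfolding char_fun_defect_op[OF assms(1)] V_def[symmetric] DAs V
    by (auto simp: row_op_def)
qed

text \<open>
  This holds as \<open>\<parallel>D\<^sub>A X\<parallel>\<^sup>2 = \<parallel>X\<parallel>\<^sup>2 - \<parallel>A X\<parallel>\<^sup>2\<close>; here it is read off from \<open>X = A\<^sup>* A X\<close>.
\<close>

lemma defect_op_zero_imp_isometric:
  assumes "DA X = 0"
  shows "norm (A X) = norm X"
proof -
  have "DA 0 = 0"
    by (rule linear_simps(3)[OF linear_defect_op])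
  then have "Aadj (A X) = X"
    using defect_op_square[of X] assms by simp
  then have "inner (A X) (A X) = inner X X"
    by (simp add: inner_cadjoint[OF clinear_row])
  then show ?thesis by (simp add: norm_eq_sqrt_inner)
qed

end

theorem proposition1:
  fixes A1 A2 :: "'a::complex_hilbert \<Rightarrow> 'a" and z1 z2 :: complex
  assumes "commuting_2_contraction A1 A2"
    and "pure_pair A1 A2"
    and "inj (defect_op_star A1 A2)"
    and "(z1, z2) \<in> unit_ball2"
  shows "(z1, z2) \<in> sigma_T1 A1 A2 \<longleftrightarrow>
    (\<exists>x. nontrivial_solution A1 A2 (z1, z2) (defect_op A1 A2 (x, 0)) \<and>
         nontrivial_solution A1 A2 (z1, z2) (defect_op A1 A2 (0, x)))"
proof -
  interpret row_contraction A1 A2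
    using assms(1) by unfold_locales (auto simp: commuting_2_contraction_def)
  have zero [simp]: "A1 0 = 0" "A2 0 = 0"
    using clinear_A1 clinear_A2
    by (simp_all add: linear_simps(3) bounded_clinear_bounded_linear)
  have kernel: "char_fun A1 A2 (z1, z2) (DA (x, 0)) = 0 \<longleftrightarrow> A1 x = z1 *\<^sub>C x"
      "char_fun A1 A2 (z1, z2) (DA (0, x)) = 0 \<longleftrightarrow> A2 x = z2 *\<^sub>C x" for x
    using char_fun_defect_op_eq_0_iff[OF assms(4,3)] by simp_all
  have small: "cmod z1 < 1" "cmod z2 < 1"
    using assms(4) abs_square_less_1[of "cmod z1"] abs_square_less_1[of "cmod z2"]
      zero_le_power2[of "cmod z1"] zero_le_power2[of "cmod z2"]
    by (simp_all add: unit_ball2_def del: zero_le_power2)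
  \<comment> \<open>Otherwise \<open>A\<close> would preserve the norm of \<open>(x, 0)\<close> or \<open>(0, x)\<close>, but there it scales by \<open>\<bar>z1\<bar>\<close> or \<open>\<bar>z2\<bar>\<close>.\<close>
  have nonzero: "DA (x, 0) \<noteq> 0" "DA (0, x) \<noteq> 0"
    if "x \<noteq> 0" "A1 x = z1 *\<^sub>C x" "A2 x = z2 *\<^sub>C x" for x
    using defect_op_zero_imp_isometric[of "(x, 0)"] defect_op_zero_imp_isometric[of "(0, x)"] that small
    by (auto simp: row_op_def norm_scaleC norm_prod_def)
  have nonzero_vector: "x \<noteq> 0" if "DA (x, 0) \<noteq> 0" for x
    using that linear_simps(3)[OF linear_defect_op] by (auto simp: zero_prod_def)
  show ?thesis
  proof
    assume "(z1, z2) \<in> sigma_T1 A1 A2"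
    then obtain x where "x \<noteq> 0" "A1 x = z1 *\<^sub>C x" "A2 x = z2 *\<^sub>C x"
      by (auto simp: sigma_T1_def)
    then show "\<exists>x. nontrivial_solution A1 A2 (z1, z2) (DA (x, 0)) \<and>
        nontrivial_solution A1 A2 (z1, z2) (DA (0, x))"
      using nonzero[of x] defect_op_in_defect_space kernel[of x] unfolding nontrivial_solution_def by blast
  next
    assume "\<exists>x. nontrivial_solution A1 A2 (z1, z2) (DA (x, 0)) \<and>
        nontrivial_solution A1 A2 (z1, z2) (DA (0, x))"
    then obtain x where "DA (x, 0) \<noteq> 0" "A1 x = z1 *\<^sub>C x" "A2 x = z2 *\<^sub>C x"
      unfolding nontrivial_solution_def kernel by blast
    then show "(z1, z2) \<in> sigma_T1 A1 A2"
      using nonzero_vector by (auto simp: sigma_T1_def)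
  qed
qed

end
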